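(* Let $(\mathcal B,p)$ be a quasimetric Boolean algebra that additionally satisfies: (QB5) for all $A,B,C\in\mathcal B$ there are $A_B,A_C\in\mathcal B$ such that $A=A_B\vee A_C$ and $p(A,B\vee C)=p(A_B,B)\vee p(A_C,C)$; (QB6) for every sequence $(A_i)_i$ in $\mathcal B$ and every $B\in\mathcal B$, if $\inf_i p(A_i,B)=0$ then $A_j\le B$ for some $j$. Then there exist a quasimetric space $(W,q)$ and an injective Boolean homomorphism $\iota$ from $\mathcal B$ into the Boolean algebra of all subsets of $W$ such that $p(A,B)=q(\iota(A),\iota(B))$ for all $A,B\in\mathcal B$, where the right side is the Hausdorff quasidistance.
   Context: $\bar{\mathbb R}^+=[0,\infty)\cup\{\infty\}$ with the usual order and addition extended by $r+\infty=\infty$; on $\bar{\mathbb R}^+$, $\vee$ denotes maximum. A Boolean algebra is separable if it is generated by a countable subset. A quasimetric Boolean algebra is a pair $(\mathcal B,p)$ where $(\mathcal B;\wedge,\vee,{}',0,1)$ is a separable Boolean algebra and $p:\mathcal B\times\mathcal B\to\bar{\mathbb R}^+$ satisfies for all $A,B,C\in\mathcal B$: (QB1) $p(A,B)=0$ iff $A\le B$; (QB2) $p(A\vee B,C)=p(A,C)\vee p(B,C)$; (QB3) $p(A,B)\le p(A,C)$ if $C\le B$; (QB4) $p(A,C)\le p(A,B)+p(B,C)$. A quasimetric on a non-empty set $W$ is $q:W\times W\to\bar{\mathbb R}^+$ with $q(v,w)=0$ iff $v=w$ and $q(v,x)\le q(v,w)+q(w,x)$ (no symmetry required). For $X,Y\subseteq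 W$ the Hausdorff quasidistance is $q(X,Y)=\sup_{x\in X}\inf_{y\in Y}q(x,y)$.
   Formalization: The algebra is assumed to have 0 ≠ 1, and p(A,B)=q(ι(A),ι(B)) is claimed for all A,B except where B=0, A≠0 and p(A,0)<∞; there it must fail, since ι(0)=∅ gives q(ι(A),∅)=∞ (e.g. {0,1} with p(1,0)=5). *)

theory Defs
  imports "HOL-Library.Extended_Nonnegative_Real" "HOL-Library.Countable_Set"
begin

definition boolean_subalgebra :: "'b::boolean_algebra set \<Rightarrow> bool" where
  "boolean_subalgebra T \<longleftrightarrow>
     bot \<in> T \<and> top \<in> T \<and> (\<forall>a\<in>T. - a \<in> T) \<and>
     (\<forall>a\<in>T. \<forall>b\<in>T. inf a b \<in> T \<and> sup a b \<in> T)"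

definition separable_boolean_algebra :: "'b::boolean_algebra itself \<Rightarrow> bool" where
  "separable_boolean_algebra _ \<longleftrightarrow>
     (\<exists>S::'b set. countable S \<and> boolean_subalgebra hull S = UNIV)"

locale quasimetric_boolean_algebra =
  fixes p :: "'b::boolean_algebra \<Rightarrow> 'b \<Rightarrow> ennreal"
  assumes separable: "separable_boolean_algebra TYPE('b)"
    and QB1: "p A B = 0 \<longleftrightarrow> A \<le> B"
    and QB2: "p (sup A B) C = max (p A C) (p B C)"
    and QB3: "C \<le> B \<Longrightarrow> p A B \<le> p A C"
    and QB4: "p A C \<le> p A B + p B C"

locale quasimetric_space =
  fixes W :: "'w set" and q :: "'w \<Rightarrow> 'w \<Rightarrow> ennreal"
  assumes nonempty: "W \<noteq> {}"
    and zero_iff: "\<lbrakk>v \<in> W; w \<in> W\<rbrakk> \<Longrightarrow> q v w = 0 \<longleftrightarrow> v = w"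
    and triangle: "\<lbrakk>v \<in> W; w \<in> W; x \<in> W\<rbrakk> \<Longrightarrow> q v x \<le> q v w + q w x"

text \<open>In \<^typ>\<open>ennreal\<close> the supremum of the empty set is \<open>0\<close> and its infimum is \<open>\<infinity>\<close>; hence the
  quasidistance from a non-empty set to the empty set is \<open>\<infinity>\<close>.\<close>

definition hausdorff_quasidist ::
    "('w \<Rightarrow> 'w \<Rightarrow> ennreal) \<Rightarrow> 'w set \<Rightarrow> 'w set \<Rightarrow> ennreal" where
  "hausdorff_quasidist q X Y = (SUP x\<in>X. INF y\<in>Y. q x y)"

definition boolean_hom_into_Pow :: "'w set \<Rightarrow> ('b::boolean_algebra \<Rightarrow> 'w set) \<Rightarrow> bool" where
  "boolean_hom_into_Pow W h \<longleftrightarrow>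
     range h \<subseteq> Pow W \<and> h bot = {} \<and> h top = W \<and>
     (\<forall>A. h (- A) = W - h A) \<and>
     (\<forall>A B. h (inf A B) = h A \<inter> h B \<and> h (sup A B) = h A \<union> h B)"

end

theory Submission
  imports Defs
begin

text \<open>
  The points of \<open>W\<close> are the ultrafilters of the algebra, and
  \<open>q v w = (SUP C\<in>w. INF D\<in>v. p D C)\<close>. Since the algebra is countable, (QB6) says that
  \<open>q v w = 0\<close> forces \<open>w \<subseteq> v\<close>. By (QB5) the map \<open>C \<mapsto> (INF D\<in>v. p D C)\<close> sends joins to minima, so
  the elements where it exceeds its value at \<open>B\<close> form an ideal; the prime ideal theorem then
  gives an ultrafilter \<open>w\<close> containing \<open>B\<close> which realises the distance from \<open>v\<close> to the image of \<open>B\<close>.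
  By (QB2) the elements \<open>D\<close> with \<open>p D B < p A B\<close> form an ideal as well, and an ultrafilter
  containing \<open>A\<close> and avoiding it realises the supremum over the image of \<open>A\<close>.
\<close>

section \<open>Ideals, ultrafilters and the prime ideal theorem\<close>

definition boolean_ideal :: "'b::boolean_algebra set \<Rightarrow> bool" where
  "boolean_ideal J \<longleftrightarrow>
     bot \<in> J \<and> (\<forall>a\<in>J. \<forall>b\<in>J. sup a b \<in> J) \<and> (\<forall>a\<in>J. \<forall>b. b \<le> a \<longrightarrow> b \<in> J)"

text \<open>Membership in \<open>U\<close> is a homomorphism to the two-element algebra; properness,
  primeness and upward closure follow from that.\<close>

definition boolean_ultrafilter :: "'b::boolean_algebra set \<Rightarrow> bool" where
  "boolean_ultrafilter U \<longleftrightarrow>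
     (\<forall>a. - a \<in> U \<longleftrightarrow> a \<notin> U) \<and> (\<forall>a b. inf a b \<in> U \<longleftrightarrow> a \<in> U \<and> b \<in> U)"

lemma boolean_ultrafilter_uminus: "boolean_ultrafilter U \<Longrightarrow> - a \<in> U \<longleftrightarrow> a \<notin> U"
  and boolean_ultrafilter_inf: "boolean_ultrafilter U \<Longrightarrow> inf a b \<in> U \<longleftrightarrow> a \<in> U \<and> b \<in> U"
  by (auto simp: boolean_ultrafilter_def)

lemma boolean_ultrafilter_sup:
  assumes "boolean_ultrafilter U"
  shows "sup a b \<in> U \<longleftrightarrow> a \<in> U \<or> b \<in> U"
proof -
  have "sup a b = - inf (- a) (- b)"
    by simp
  then show ?thesis
    using assms by (simp only: boolean_ultrafilter_uminus boolean_ultrafilter_inf) simp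
qed

lemma boolean_ultrafilter_bot:
  assumes "boolean_ultrafilter U"
  shows "bot \<notin> U"
  using boolean_ultrafilter_inf[OF assms, of bot "- bot"] boolean_ultrafilter_uminus[OF assms, of bot]
  by auto

lemma boolean_ultrafilter_top:
  assumes "boolean_ultrafilter U"
  shows "top \<in> U"
  using boolean_ultrafilter_bot[OF assms] boolean_ultrafilter_uminus[OF assms, of bot] by simp

lemma boolean_ultrafilter_mono:
  assumes "boolean_ultrafilter U" "a \<in> U" "a \<le> b"
  shows "b \<in> U"
  using boolean_ultrafilter_inf[OF assms(1), of a b] assms(2,3) by (simp add: inf_absorb1)

text \<open>If \<open>a\<close> lay in \<open>V\<close> but not in \<open>U\<close>, then
  \<open>- a\<close> would lie in \<open>U\<close>, hence in \<open>V\<close> together with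
  \<open>a\<close>.\<close>

lemma boolean_ultrafilter_eqI:
  assumes U: "boolean_ultrafilter U" and V: "boolean_ultrafilter V" and "U \<subseteq> V"
  shows "U = V"
  using assms boolean_ultrafilter_uminus[OF U] boolean_ultrafilter_uminus[OF V] by blast

text \<open>This is the ideal generated by \<open>J\<close> and \<open>x\<close>, to be tested
  against the maximality of \<open>J\<close>.\<close>

lemma boolean_ideal_adjoin:
  assumes J: "boolean_ideal J"
  shows "boolean_ideal {y. \<exists>j\<in>J. y \<le> sup j x}"
proof -
  let ?K = "{y. \<exists>j\<in>J. y \<le> sup j x}"
  have "bot \<in> ?K"
    using J by (auto simp: boolean_ideal_def)
  moreover have "sup a b \<in> ?K" if "a \<in> ?K" "b \<in> ?K" for a b
  proof -
    obtain j k where jk: "j \<in> J" "a \<le> sup j x" "k \<in> J" "b \<le> sup k x"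
      using \<open>a \<in> ?K\<close> \<open>b \<in> ?K\<close> by auto
    have "sup a b \<le> sup (sup j x) (sup k x)"
      using jk by (intro sup_mono)
    also have "\<dots> = sup (sup j k) x"
      by (simp add: ac_simps)
    finally have "sup a b \<le> sup (sup j k) x" .
    moreover have "sup j k \<in> J"
      using J jk unfolding boolean_ideal_def by blast
    ultimately show ?thesis
      by blast
  qed
  moreover have "b \<in> ?K" if "a \<in> ?K" "b \<le> a" for a b
    using that by (auto intro: order_trans)
  ultimately show ?thesis
    unfolding boolean_ideal_def by blast
qed

text \<open>By maximality, adjoining any \<open>x\<close> outside \<open>J\<close> captures
  \<open>A\<close>. If \<open>a\<close> and \<open>- a\<close> were both outside, distributivity
  would put \<open>A\<close> below a join of two elements of \<open>J\<close>. If both were inside,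
  \<open>top\<close> and with it \<open>A\<close> would be in \<open>J\<close>.\<close>

lemma boolean_ultrafilter_compl_maximal_ideal:
  assumes J: "boolean_ideal J" and A: "A \<notin> J"
    and max: "\<And>K. boolean_ideal K \<Longrightarrow> A \<notin> K \<Longrightarrow> J \<subseteq> K \<Longrightarrow> K = J"
  shows "boolean_ultrafilter (- J)"
proof -
  have sup_closed: "sup a b \<in> J" if "a \<in> J" "b \<in> J" for a b
    using J that by (auto simp: boolean_ideal_def)
  have down: "b \<in> J" if "a \<in> J" "b \<le> a" for a b
    using J that by (auto simp: boolean_ideal_def)
  have cover: "\<exists>j\<in>J. A \<le> sup j x" if "x \<notin> J" for x
  proof (rule ccontr)
    assume none: "\<not> (\<exists>j\<in>J. A \<le> sup j x)"
    let ?K = "{y. \<exists>j\<in>J. y \<le> sup j x}"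
    have "J \<subseteq> ?K"
      by (auto intro: sup.coboundedI1)
    moreover have "x \<in> ?K"
      using J by (auto simp: boolean_ideal_def)
    moreover have "?K = J"
      using max[OF boolean_ideal_adjoin[OF J]] none \<open>J \<subseteq> ?K\<close> by simp
    ultimately show False
      using that by blast
  qed
  have compl: "- a \<in> J" if a: "a \<notin> J" for a
  proof (rule ccontr)
    assume na: "- a \<notin> J"
    obtain j k where j: "j \<in> J" "A \<le> sup j a" and k: "k \<in> J" "A \<le> sup k (- a)"
      using cover[OF a] cover[OF na] by blast
    have "A \<le> sup (sup j k) a"
      using j(2) by (rule order_trans) (simp add: le_supI1)
    moreover have "A \<le> sup (sup j k) (- a)"
      using k(2) by (rule order_trans) (simp add: le_supI1)
    ultimately have "A \<le> inf (sup (sup j k) a) (sup (sup j k) (- a))"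
      by simp
    also have "\<dots> = sup j k"
      by (simp flip: sup_inf_distrib1)
    finally show False
      using A down sup_closed j(1) k(1) by blast
  qed
  have excl: "- a \<notin> J" if "a \<in> J" for a
    using sup_closed[OF that, of "- a"] down[of top A] A by auto
  have "inf a b \<notin> J" if "a \<notin> J" "b \<notin> J" for a b
    using sup_closed[OF compl compl, OF that] excl[of "inf a b"] by auto
  moreover have "a \<notin> J" "b \<notin> J" if "inf a b \<notin> J" for a b
    using that down[of a "inf a b"] down[of b "inf a b"] by auto
  ultimately have "inf a b \<notin> J \<longleftrightarrow> a \<notin> J \<and> b \<notin> J" for a b
    by metis
  moreover have "- a \<notin> J \<longleftrightarrow> a \<in> J" for a
    using compl excl by metis
  ultimately show ?thesis
    by (simp add: boolean_ultrafilter_def)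
qed

theorem boolean_prime_ideal:
  assumes I: "boolean_ideal I" and A: "A \<notin> I"
  obtains U where "boolean_ultrafilter U" "A \<in> U" "U \<inter> I = {}"
proof -
  let ?S = "{J. boolean_ideal J \<and> I \<subseteq> J \<and> A \<notin> J}"
  have "\<exists>J\<in>?S. \<forall>K\<in>?S. J \<subseteq> K \<longrightarrow> K = J"
  proof (rule subset_Zorn_nonempty)
    show "?S \<noteq> {}"
      using I A by auto
  next
    fix \<C> assume ne: "\<C> \<noteq> {}" and chain: "subset.chain ?S \<C>"
    have sub: "\<C> \<subseteq> ?S"
      using chain by (simp add: subset.chain_def)
    have "sup a b \<in> \<Union>\<C>" if ab: "a \<in> \<Union>\<C>" "b \<in> \<Union>\<C>" for a b
    proof -
      obtain J K where JK: "J \<in> \<C>" "a \<in> J" "K \<in> \<C>" "b \<in> K"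
        using ab by blast
      \<comment> \<open>In a chain one of the two ideals contains the other, so a single member
        holds both \<open>a\<close> and \<open>b\<close>.\<close>
      then have "J \<subseteq> K \<or> K \<subseteq> J"
        using chain unfolding subset_chain_def by blast
      then obtain L where "L \<in> \<C>" "a \<in> L" "b \<in> L"
        using JK by blast
      then show ?thesis
        using sub unfolding boolean_ideal_def by blast
    qed
    moreover have "bot \<in> \<Union>\<C>" "\<forall>a\<in>\<Union>\<C>. \<forall>b. b \<le> a \<longrightarrow> b \<in> \<Union>\<C>"
      using sub ne unfolding boolean_ideal_def by blast+
    ultimately have "boolean_ideal (\<Union>\<C>)"
      unfolding boolean_ideal_def by blast
    then show "\<Union>\<C> \<in> ?S"
      using sub ne by blast
  qed
  then obtain J where "J \<in> ?S" and max: "\<forall>K\<in>?S. J \<subseteq> K \<longrightarrow> K = J"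
    by (rule bexE)
  then have J: "boolean_ideal J" "I \<subseteq> J" "A \<notin> J"
    by simp_all
  have "boolean_ultrafilter (- J)"
  proof (rule boolean_ultrafilter_compl_maximal_ideal[OF J(1,3)])
    fix K assume "boolean_ideal K" "A \<notin> K" "J \<subseteq> K"
    moreover from this have "K \<in> ?S"
      using J(2) by simp
    ultimately show "K = J"
      using max by simp
  qed
  moreover have "A \<in> - J" "- J \<inter> I = {}"
    using J by auto
  ultimately show thesis
    by (rule that)
qed

lemma boolean_ideal_bot: "boolean_ideal {bot}"
  by (auto simp: boolean_ideal_def bot_unique)

section \<open>Countability of countably generated Boolean algebras\<close>

lemma countable_boolean_subalgebra_hull:
  fixes S :: "'b::boolean_algebra set"
  assumes "countable S"
  shows "countable (boolean_subalgebra hull S)"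
proof -
  \<comment> \<open>The hull is covered by countably many stages, each obtained by one round of the
    operations and still countable.\<close>
  define step where "step T = T \<union> uminus ` T \<union> case_prod inf ` (T \<times> T) \<union> case_prod sup ` (T \<times> T)"
    for T :: "'b set"
  define T where "T n = (step ^^ n) (S \<union> {bot, top})" for n
  have T_Suc: "T (Suc n) = step (T n)" for n
    by (simp add: T_def)
  have "countable (T n)" for n
    by (induction n) (simp_all add: assms T_Suc, simp_all add: T_def step_def assms)
  then have "countable (\<Union>n. T n)"
    by blast
  moreover have "boolean_subalgebra hull S \<subseteq> (\<Union>n. T n)"
  proof (rule hull_minimal)
    show "S \<subseteq> (\<Union>n. T n)"
      by (auto simp: T_def intro!: exI[of _ 0])
    have mono: "T m \<subseteq> T n" if "m \<le> n" for m n
      using that by (rule lift_Suc_mono_le[rotated]) (auto simp: T_Suc step_def)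
    have "bot \<in> T 0" "top \<in> T 0"
      by (auto simp: T_def)
    moreover have "- a \<in> T (Suc n)" if "a \<in> T n" for a n
      using that by (auto simp: T_Suc step_def)
    \<comment> \<open>The stages increase, so both arguments are present at stage
      \<open>max m n\<close> and the results one stage later.\<close>
    moreover have "inf a b \<in> T (Suc (max m n)) \<and> sup a b \<in> T (Suc (max m n))"
      if "a \<in> T m" "b \<in> T n" for a b m n
    proof -
      have "a \<in> T (max m n)" "b \<in> T (max m n)"
        using that mono[of m "max m n"] mono[of n "max m n"] by auto
      then show ?thesis
        by (force simp: T_Suc step_def)
    qed
    ultimately show "boolean_subalgebra (\<Union>n. T n)"
      unfolding boolean_subalgebra_def by auto metis+
  qed
  ultimately show ?thesis
    by (rule countable_subset[rotated])
qed

section \<open>The quasimetric on ultrafilters and the two distance formulas\<close>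

lemma ennreal_le_add_INF:
  fixes y c :: ennreal
  assumes "I \<noteq> {}" and le: "\<And>i. i \<in> I \<Longrightarrow> y \<le> c + f i"
  shows "y \<le> c + (INF i\<in>I. f i)"
\<comment> \<open>For finite \<open>c\<close>, subtracting it from \<open>y\<close> leaves a lower
  bound of all \<open>f i\<close>; for \<open>c = top\<close> the right side is
  \<open>top\<close>.\<close>
proof (cases "c = top")
  case False
  have "y - c \<le> (INF i\<in>I. f i)"
    using le by (intro INF_greatest) (auto simp: ennreal_minus_le_iff False)
  then show ?thesis
    using False by (simp add: ennreal_minus_le_iff)
qed simp

text \<open>On ultrafilters both operators are monotone limits, as \<open>p D C\<close> cannot grow
  when \<open>D\<close> shrinks nor fall when \<open>C\<close> shrinks. The inner one measures the
  distance from the point \<open>v\<close> to the set named by \<open>C\<close>.\<close>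

definition ultrafilter_quasidist ::
    "('b \<Rightarrow> 'b \<Rightarrow> ennreal) \<Rightarrow> 'b set \<Rightarrow> 'b set \<Rightarrow> ennreal" where
  "ultrafilter_quasidist p v w = (SUP C\<in>w. INF D\<in>v. p D C)"

context quasimetric_boolean_algebra
begin

text \<open>(QB6) concerns sequences; countability lets it be applied to an ultrafilter by
  enumerating it.\<close>

lemma countable_subset_algebra: "countable (X :: 'b set)"
proof -
  obtain S :: "'b set" where "countable S" "boolean_subalgebra hull S = UNIV"
    using separable unfolding separable_boolean_algebra_def by blast
  then have "countable (UNIV :: 'b set)"
    using countable_boolean_subalgebra_hull by metis
  then show ?thesis
    by (rule countable_subset[rotated]) simp
qed

lemma p_mono: "A \<le> B \<Longrightarrow> p A C \<le> p B C"
  by (metis QB2 max.cobounded1 sup_absorb2)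

text \<open>For fixed \<open>C\<close> in \<open>x\<close>, (QB4) passes through an arbitrary
  \<open>B\<close> in \<open>w\<close>. The infimum over \<open>D\<close> bounds the first leg by
  the distance from \<open>v\<close> to \<open>w\<close>; the infimum over \<open>B\<close> then
  handles the second leg.\<close>

lemma ultrafilter_quasidist_triangle:
  assumes "w \<noteq> {}"
  shows "ultrafilter_quasidist p v x \<le> ultrafilter_quasidist p v w + ultrafilter_quasidist p w x"
  unfolding ultrafilter_quasidist_def[of p v x]
proof (rule SUP_least)
  fix C assume C: "C \<in> x"
  let ?q = "ultrafilter_quasidist p v w"
  show "(INF D\<in>v. p D C) \<le> ?q + ultrafilter_quasidist p w x"
  proof (cases "v = {}")
    case True
    \<comment> \<open>Over the empty \<open>v\<close> every infimum is infinite, and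
      \<open>w\<close> supplies at least one term of the supremum.\<close>
    then have "?q = top"
      using assms by (simp add: ultrafilter_quasidist_def)
    then show ?thesis
      by simp
  next
    case False
    have "(INF D\<in>v. p D C) \<le> ?q + p B C" if B: "B \<in> w" for B
    proof -
      have "(INF D\<in>v. p D C) \<le> p B C + (INF D\<in>v. p D B)"
        using False
      proof (rule ennreal_le_add_INF)
        fix D assume "D \<in> v"
        then have "(INF D\<in>v. p D C) \<le> p D C"
          by (rule INF_lower)
        also have "\<dots> \<le> p B C + p D B"
          using QB4[of D C B] by (simp add: add.commute)
        finally show "(INF D\<in>v. p D C) \<le> p B C + p D B" .
      qed
      also have "\<dots> \<le> p B C + ?q"
        unfolding ultrafilter_quasidist_def by (intro add_left_mono SUP_upper B)
      finally show ?thesis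
        by (simp add: add.commute)
    qed
    then have "(INF D\<in>v. p D C) \<le> ?q + (INF B\<in>w. p B C)"
      using assms by (intro ennreal_le_add_INF)
    also have "\<dots> \<le> ?q + ultrafilter_quasidist p w x"
      unfolding ultrafilter_quasidist_def[of p w x] by (intro add_left_mono SUP_upper C)
    finally show ?thesis .
  qed
qed

lemma ultrafilter_quasidist_self: "ultrafilter_quasidist p v v = 0"
proof -
  have "(INF D\<in>v. p D C) \<le> 0" if "C \<in> v" for C
    using that QB1[of C C] by (intro INF_lower2[of C]) auto
  then show ?thesis
    unfolding ultrafilter_quasidist_def by (intro antisym SUP_least) auto
qed

lemma ultrafilter_quasidist_eq_0_iff:
  assumes QB6: "\<And>(A :: nat \<Rightarrow> 'b) B. (INF i. p (A i) B) = 0 \<Longrightarrow> \<exists>j. A j \<le> B"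
    and v: "boolean_ultrafilter v" and w: "boolean_ultrafilter w"
  shows "ultrafilter_quasidist p v w = 0 \<longleftrightarrow> v = w"
proof
  assume zero: "ultrafilter_quasidist p v w = 0"
  have ne: "v \<noteq> {}"
    using boolean_ultrafilter_top[OF v] by blast
  have "C \<in> v" if C: "C \<in> w" for C
  proof -
    have "(INF D\<in>v. p D C) \<le> ultrafilter_quasidist p v w"
      unfolding ultrafilter_quasidist_def by (intro SUP_upper C)
    \<comment> \<open>\<open>from_nat_into v\<close> lists the countable set \<open>v\<close>,
      perhaps with repetitions, as the sequence that (QB6) asks for.\<close>
    then have "(INF D\<in>range (from_nat_into v). p D C) = 0"
      using zero by (simp add: range_from_nat_into[OF ne countable_subset_algebra])
    then obtain j where "from_nat_into v j \<le> C"
      using QB6[of "from_nat_into v" C] by (auto simp: image_image)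
    then show ?thesis
      using boolean_ultrafilter_mono[OF v from_nat_into[OF ne]] by blast
  qed
  then show "v = w"
    using boolean_ultrafilter_eqI[OF w v] by blast
qed (simp add: ultrafilter_quasidist_self)

text \<open>(QB5) splits \<open>D\<close> into two pieces; \<open>v\<close> is prime and so contains
  one of them, whose value is an upper bound for one of the two infima.\<close>

lemma INF_ultrafilter_sup:
  assumes QB5: "\<And>A B C. \<exists>A\<^sub>B A\<^sub>C. A = sup A\<^sub>B A\<^sub>C \<and> p A (sup B C) = max (p A\<^sub>B B) (p A\<^sub>C C)"
    and v: "boolean_ultrafilter v"
  shows "(INF D\<in>v. p D (sup B C)) = min (INF D\<in>v. p D B) (INF D\<in>v. p D C)"
proof (rule antisym)
  show "(INF D\<in>v. p D (sup B C)) \<le> min (INF D\<in>v. p D B) (INF D\<in>v. p D C)"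
    by (auto intro!: INF_mono' QB3)
  show "min (INF D\<in>v. p D B) (INF D\<in>v. p D C) \<le> (INF D\<in>v. p D (sup B C))"
  proof (rule INF_greatest)
    fix D assume "D \<in> v"
    obtain E F where EF: "D = sup E F" "p D (sup B C) = max (p E B) (p F C)"
      using QB5[of D B C] by blast
    then have "E \<in> v \<or> F \<in> v"
      using \<open>D \<in> v\<close> boolean_ultrafilter_sup[OF v] by simp
    then have "(INF D\<in>v. p D B) \<le> p E B \<or> (INF D\<in>v. p D C) \<le> p F C"
      by (auto intro: INF_lower)
    then show "min (INF D\<in>v. p D B) (INF D\<in>v. p D C) \<le> p D (sup B C)"
      by (auto simp: EF(2) min_le_iff_disj le_max_iff_disj)
  qed
qed

lemma INF_ultrafilter_quasidist:
  assumes QB5: "\<And>A B C. \<exists>A\<^sub>B A\<^sub>C. A = sup A\<^sub>B A\<^sub>C \<and> p A (sup B C) = max (p A\<^sub>B B) (p A\<^sub>C C)"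
    and v: "boolean_ultrafilter v" and B: "B \<noteq> bot"
  shows "(INF w\<in>{w. boolean_ultrafilter w \<and> B \<in> w}. ultrafilter_quasidist p v w) = (INF D\<in>v. p D B)"
proof (rule antisym)
  let ?f = "\<lambda>C. INF D\<in>v. p D C"
  \<comment> \<open>An ideal must contain \<open>bot\<close>, but \<open>?f B < ?f bot\<close> may
    fail, for instance when \<open>?f B\<close> is infinite; hence \<open>bot\<close> is added by
    hand. Since \<open>B\<close> is not \<open>bot\<close>, it stays outside.\<close>
  let ?I = "{C. ?f B < ?f C} \<union> {bot}"
  have "?f C \<le> ?f C'" if "C' \<le> C" for C C'
    using that by (intro INF_mono' QB3)
  then have "boolean_ideal ?I"
    unfolding boolean_ideal_def
    by (auto simp: INF_ultrafilter_sup[OF QB5 v] bot_unique intro: less_le_trans)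
  moreover have "B \<notin> ?I"
    using B by simp
  ultimately obtain w where w: "boolean_ultrafilter w" "B \<in> w" "w \<inter> ?I = {}"
    using boolean_prime_ideal by blast
  \<comment> \<open>Since \<open>w\<close> avoids \<open>?I\<close>, no \<open>C\<close> in
    \<open>w\<close> has \<open>?f C\<close> above \<open>?f B\<close>.\<close>
  then have "ultrafilter_quasidist p v w \<le> ?f B"
    unfolding ultrafilter_quasidist_def by (intro SUP_least) (auto simp: not_less[symmetric])
  then show "(INF w\<in>{w. boolean_ultrafilter w \<and> B \<in> w}. ultrafilter_quasidist p v w) \<le> ?f B"
    using w by (intro INF_lower2[of w]) auto
  show "?f B \<le> (INF w\<in>{w. boolean_ultrafilter w \<and> B \<in> w}. ultrafilter_quasidist p v w)"
    by (intro INF_greatest) (auto simp: ultrafilter_quasidist_def intro: SUP_upper)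
qed

lemma SUP_ultrafilter_INF:
  "(SUP v\<in>{v. boolean_ultrafilter v \<and> A \<in> v}. INF D\<in>v. p D B) = p A B"
proof (rule antisym)
  show "(SUP v\<in>{v. boolean_ultrafilter v \<and> A \<in> v}. INF D\<in>v. p D B) \<le> p A B"
    by (auto intro!: SUP_least INF_lower)
  show "p A B \<le> (SUP v\<in>{v. boolean_ultrafilter v \<and> A \<in> v}. INF D\<in>v. p D B)"
  \<comment> \<open>The strict inequality defining \<open>?I\<close> admits \<open>bot\<close> only
    when \<open>p A B\<close> is nonzero.\<close>
  proof (cases "p A B = 0")
    case False
    let ?I = "{D. p D B < p A B}"
    have "p bot B = 0"
      using QB1 by simp
    then have "boolean_ideal ?I"
      using False unfolding boolean_ideal_def
      by (auto simp: QB2 zero_less_iff_neq_zero intro: le_less_trans[OF p_mono])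
    then obtain v where v: "boolean_ultrafilter v" "A \<in> v" "v \<inter> ?I = {}"
      using boolean_prime_ideal[of ?I A] by blast
    then have "p A B \<le> (INF D\<in>v. p D B)"
      by (intro INF_greatest) (auto simp: not_less[symmetric])
    then show ?thesis
      using v by (intro SUP_upper2[of v]) auto
  qed simp
qed

end

section \<open>Stone representation and the embedding theorem\<close>

lemma boolean_hom_ultrafilters:
  "boolean_hom_into_Pow {v :: 'b::boolean_algebra set. boolean_ultrafilter v}
     (\<lambda>A. {v. boolean_ultrafilter v \<and> A \<in> v})"
  by (auto simp: boolean_hom_into_Pow_def boolean_ultrafilter_bot boolean_ultrafilter_top
      boolean_ultrafilter_uminus boolean_ultrafilter_inf boolean_ultrafilter_sup)

text \<open>If \<open>A\<close> is not below \<open>B\<close>, an ultrafilter through the nonzero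
  \<open>inf A (- B)\<close> contains \<open>A\<close> but not \<open>B\<close>.\<close>

lemma inj_ultrafilters: "inj (\<lambda>A :: 'b::boolean_algebra. {v. boolean_ultrafilter v \<and> A \<in> v})"
proof -
  have le: "A \<le> B"
    if sub: "{v. boolean_ultrafilter v \<and> A \<in> v} \<subseteq> {v. boolean_ultrafilter v \<and> B \<in> v}" for A B :: 'b
  proof (rule ccontr)
    assume "\<not> A \<le> B"
    then have "inf A (- B) \<notin> {bot}"
      by (simp add: inf_shunt)
    then obtain v where "boolean_ultrafilter v" "inf A (- B) \<in> v"
      using boolean_prime_ideal[OF boolean_ideal_bot] by blast
    then show False
      using sub by (auto simp: boolean_ultrafilter_inf boolean_ultrafilter_uminus)
  qed
  show ?thesis
    by (intro injI antisym le) auto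
qed

text \<open>The image of \<open>bot\<close> is empty, and the quasidistance to the empty set is
  infinite from every nonempty set and zero from the empty one; hence the side condition at
  \<open>B = bot\<close>.\<close>

theorem theorem4p3:
  fixes p :: "'b::boolean_algebra \<Rightarrow> 'b \<Rightarrow> ennreal"
  assumes nondegenerate: "(bot::'b) \<noteq> top"
    and qba: "quasimetric_boolean_algebra p"
    and QB5: "\<And>A B C. \<exists>A\<^sub>B A\<^sub>C. A = sup A\<^sub>B A\<^sub>C \<and> p A (sup B C) = max (p A\<^sub>B B) (p A\<^sub>C C)"
    and QB6: "\<And>(A :: nat \<Rightarrow> 'b) B. (INF i. p (A i) B) = 0 \<Longrightarrow> \<exists>j. A j \<le> B"
  shows "\<exists>(W :: 'b set set) q \<iota>.
           quasimetric_space W q \<and> boolean_hom_into_Pow W \<iota> \<and> inj \<iota> \<and>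
           (\<forall>A B. (B = bot \<longrightarrow> A = bot \<or> p A bot = \<infinity>) \<longrightarrow>
              p A B = hausdorff_quasidist q (\<iota> A) (\<iota> B))"
proof -
  interpret quasimetric_boolean_algebra p
    by (rule qba)
  define W where "W = {v :: 'b set. boolean_ultrafilter v}"
  define q where "q = ultrafilter_quasidist p"
  define \<iota> where "\<iota> A = {v. boolean_ultrafilter v \<and> A \<in> v}" for A :: 'b
  have hom: "boolean_hom_into_Pow W \<iota>" and inj: "inj \<iota>"
    unfolding W_def \<iota>_def by (rule boolean_hom_ultrafilters inj_ultrafilters)+
  have \<iota>_bot: "\<iota> bot = {}"
    using hom by (simp add: boolean_hom_into_Pow_def)
  have "W = \<iota> top"
    using hom by (simp add: boolean_hom_into_Pow_def)
  \<comment> \<open>Injectivity separates the images of \<open>bot\<close> and \<open>top\<close>,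
    so \<open>W\<close> cannot be empty.\<close>
  then have "W \<noteq> {}"
    using injD[OF inj, of bot top] nondegenerate \<iota>_bot by auto
  have "quasimetric_space W q"
  proof (rule quasimetric_space.intro[OF \<open>W \<noteq> {}\<close>])
    fix v w x assume "v \<in> W" "w \<in> W"
    then show "q v w = 0 \<longleftrightarrow> v = w"
      unfolding W_def q_def by (simp add: ultrafilter_quasidist_eq_0_iff QB6)
    from \<open>w \<in> W\<close> have "w \<noteq> {}"
      using boolean_ultrafilter_top by (auto simp: W_def)
    then show "q v x \<le> q v w + q w x"
      by (simp add: q_def ultrafilter_quasidist_triangle)
  qed
  moreover have "p A B = hausdorff_quasidist q (\<iota> A) (\<iota> B)"
    if cond: "B = bot \<longrightarrow> A = bot \<or> p A bot = \<infinity>" for A B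
  \<comment> \<open>No ultrafilter contains \<open>bot\<close>, so the prime ideal argument covers
    only the other \<open>B\<close>; at \<open>bot\<close> the values come from the empty supremum
    and infimum.\<close>
  proof (cases "B = bot")
    case False
    have "hausdorff_quasidist q (\<iota> A) (\<iota> B) = (SUP v\<in>\<iota> A. INF D\<in>v. p D B)"
      unfolding hausdorff_quasidist_def q_def \<iota>_def
      by (intro SUP_cong refl INF_ultrafilter_quasidist[OF QB5 _ False]) auto
    then show ?thesis
      by (simp add: \<iota>_def SUP_ultrafilter_INF)
  next
    case True
    show ?thesis
    proof (cases "A = bot")
      case True
      then show ?thesis
        using \<iota>_bot QB1[of A B] by (simp add: hausdorff_quasidist_def bot_ennreal)
    next
      case False
      then have "\<iota> A \<noteq> {}"
        using injD[OF inj, of A bot] \<iota>_bot by auto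
      then show ?thesis
        using False cond \<open>B = bot\<close> \<iota>_bot by (simp add: hausdorff_quasidist_def)
    qed
  qed
  ultimately show ?thesis
    using hom inj by (intro exI[of _ W] exI[of _ q] exI[of _ \<iota>]) simp
qed

end
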